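(* Let $p,q\in[1,\infty)$. For $a\in[0,1)$ put $$A_{p,q}(a)=\frac{(1-a^p)^{1/q}}{1-a^2+a(1-a^p)^{1/q}},\qquad S_{p,q}(a)=\left(\frac{(1-a^p)^{2/q}}{1-a^2+(1-a^p)^{2/q}}\right)^{1/2},$$ and let $\widehat a$ be the unique root in $(0,1)$ of $x^p+x^q=1$. Then: (i) if $p,q\in[1,2]$, $R_{p,q}(\mathbb C)=\inf_{a\in[\widehat a,1)}A_{p,q}(a)$; (ii) if $p\in(2,\infty)$ and $q\in[1,2]$, $R_{p,q}(\mathbb C)=\min\{1/\sqrt2,\ \inf_{a\in[\widehat a,1)}A_{p,q}(a)\}$; (iii) if $p,q\in[2,\infty)$, $R_{p,q}(\mathbb C)=1/\sqrt2$; (iv) if $q\in(2,\infty)$, then $R_{2,q}(\mathbb C)=1/\sqrt2$; and if $p\in[1,2)$, $q\in(2,\infty)$ and moreover $q\widehat a^{2}+p\widehat a^{p+2}\le p\widehat a^{p}+q\widehat a^{p+2}$, then $R_{p,q}(\mathbb C)=\inf_{a\in[\widehat a,1)}A_{p,q}(a)$; (v) in general, for $p\in[1,2)$ and $q\in(2,\infty)$, $$0<\inf_{a\in[0,1)}S_{p,q}(a)\le R_{p,q}(\mathbb C)\le \frac1{\sqrt2}.$$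
   Context: $\mathbb D$ is the open unit disk. For a complex Banach space $X$ and $p,q\in[1,\infty)$, and a holomorphic $f:\mathbb D\to X$, $f(z)=\sum_{k\ge0}x_kz^k$, with $\sup_{z\in\mathbb D}\|f(z)\|\le1$, let $R_{p,q}(f,X)=\sup\{r\ge0:\ \|x_0\|^p+(\sum_{k\ge1}\|x_k\|\,|z|^k)^q\le1 \text{ for all } |z|<r\}$, and $R_{p,q}(X)=\inf\{R_{p,q}(f,X): f:\mathbb D\to X \text{ holomorphic}, \sup_{\mathbb D}\|f\|\le1\}$. Here $X=\mathbb C$ with the modulus. *)

theory Defs
  imports "HOL-Complex_Analysis.Complex_Analysis"
begin

definition taylor_coeff :: "(complex \<Rightarrow> complex) \<Rightarrow> nat \<Rightarrow> complex" where
  "taylor_coeff f k = (deriv ^^ k) f 0 / of_nat (fact k)"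

definition bohr_admissible :: "(complex \<Rightarrow> complex) \<Rightarrow> bool" where
  "bohr_admissible f \<longleftrightarrow> f holomorphic_on ball 0 1 \<and> (\<forall>z\<in>ball 0 1. norm (f z) \<le> 1)"

text \<open>R_{p,q}(f,C), valued in extended reals (it may be +infinity, e.g. for unimodular constants).
  The (possibly infinite) series of nonnegative terms is required to converge for the inequality to hold.\<close>
definition bohr_radius_f :: "real \<Rightarrow> real \<Rightarrow> (complex \<Rightarrow> complex) \<Rightarrow> ereal" where
  "bohr_radius_f p q f = Sup {ereal r | r. 0 \<le> r \<and>
      (\<forall>z::complex. norm z < r \<longrightarrow>
         summable (\<lambda>k. norm (taylor_coeff f (Suc k)) * norm z ^ Suc k) \<and>
         norm (taylor_coeff f 0) powr p
           + (\<Sum>k. norm (taylor_coeff f (Suc k)) * norm z ^ Suc k) powr q \<le> 1)}"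

definition bohr_radius_C :: "real \<Rightarrow> real \<Rightarrow> ereal" where
  "bohr_radius_C p q = Inf {bohr_radius_f p q f | f. bohr_admissible f}"

definition A_pq :: "real \<Rightarrow> real \<Rightarrow> real \<Rightarrow> real" where
  "A_pq p q a = (1 - a powr p) powr (1/q) / (1 - a^2 + a * (1 - a powr p) powr (1/q))"

definition S_pq :: "real \<Rightarrow> real \<Rightarrow> real \<Rightarrow> real" where
  "S_pq p q a = sqrt ((1 - a powr p) powr (2/q) / (1 - a^2 + (1 - a powr p) powr (2/q)))"

definition a_hat :: "real \<Rightarrow> real \<Rightarrow> real" where
  "a_hat p q = (THE x. 0 < x \<and> x < 1 \<and> x powr p + x powr q = 1)"

end

theory Submission
  imports Defs
begin

text \<open>
  Let \<open>a = |x\<^sub>0| < 1\<close>, \<open>F = f - x\<^sub>0\<close> and \<open>G = 1 - a\<^sup>2 - cnj x\<^sub>0 F\<close>. The Schwarz-Pick lemma gives \<open>|F z| \<le> |z| |G z|\<close>;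
  integrating the squares over \<open>|z|\<^sup>2 = \<rho>\<close> and using Parseval on both sides yields
  \<open>(\<Sum>k\<ge>1. |x\<^sub>k|\<^sup>2 \<rho> ^ k) \<le> \<rho> (1 - a\<^sup>2)\<^sup>2 / (1 - a\<^sup>2 \<rho>)\<close>.
  By Cauchy-Schwarz with \<open>\<rho> = r / a\<close> (allowed for \<open>r \<le> a\<close>), respectively \<open>\<rho> = 1\<close>, the Bohr inequality
  holds at \<open>r\<close> if \<open>r \<le> A_pq p q a\<close> and \<open>r \<le> a\<close>, or if \<open>r \<le> S_pq p q a\<close>. One has \<open>A_pq p q a \<le> a\<close> for \<open>a \<ge> a_hat p q\<close>, and both
  functions take the value \<open>a_hat p q\<close> at \<open>a_hat p q\<close>. Moebius maps show that every \<open>A_pq p q a\<close> is an upper bound for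
  the Bohr radius, and \<open>z (c - z) / (1 - c z)\<close> with \<open>c = 1 / sqrt 2\<close> shows that \<open>1 / sqrt 2\<close> is one. What remains is
  to bound \<open>S_pq p q\<close> from below on \<open>[0, a_hat p q]\<close>, where it is monotone or first increases and then decreases.
\<close>

subsection \<open>Taylor coefficients of bounded holomorphic functions\<close>

lemma taylor_coeff_sums:
  assumes "f holomorphic_on ball 0 1" "norm z < 1"
  shows "(\<lambda>k. taylor_coeff f k * z ^ k) sums f z"
  using holomorphic_power_series[OF assms(1), of z] assms(2) by (simp add: taylor_coeff_def)

lemma taylor_coeff_eqI:
  assumes "\<And>z. norm z < 1 \<Longrightarrow> (\<lambda>k. c k * z ^ k) sums f z"
  shows "taylor_coeff f k = c k"
proof -
  have "\<forall>\<^sub>F z in nhds 0. z \<in> ball (0::complex) 1"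
    by (rule eventually_nhds_in_open) auto
  then have "\<forall>\<^sub>F z in nhds 0. (\<lambda>k. fps_nth (Abs_fps c) k * z ^ k) sums f z"
    by eventually_elim (use assms in auto)
  then have "f has_fps_expansion Abs_fps c"
    by (rule has_fps_expansionI)
  from fps_nth_fps_expansion[OF this, of k] show ?thesis
    by (simp add: taylor_coeff_def)
qed

lemma taylor_coeff_abs_summable:
  assumes "f holomorphic_on ball 0 1" "0 \<le> r" "r < 1"
  shows "summable (\<lambda>k. norm (taylor_coeff f k) * r ^ k)"
proof -
  have "summable (\<lambda>k. taylor_coeff f k * of_real ((1 + r) / 2) ^ k)"
    using assms by (intro sums_summable[OF taylor_coeff_sums]) (auto simp del: of_real_divide of_real_add)
  from powser_insidea[OF this, of "of_real r"] show ?thesis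
    using assms by (simp del: of_real_divide of_real_add add: norm_mult norm_power)
qed

lemma taylor_coeff_integral:
  fixes r :: real
  assumes "f holomorphic_on ball 0 1" "0 < r" "r < 1"
  shows "((\<lambda>t. f (r * exp (2 * of_real pi * \<i> * of_real t)) * cnj (exp (2 * of_real pi * \<i> * of_real t) ^ k))
     has_integral taylor_coeff f k * r ^ k) {0..1}"
proof -
  define e where "e t = exp (2 * of_real pi * \<i> * of_real t)" for t :: real
  have [simp]: "e t \<noteq> 0" "norm (e t) = 1" for t
    by (simp_all add: e_def norm_exp_eq_Re)
  have cnj_e: "cnj (e t) = inverse (e t)" for t
    using complex_norm_square[of "e t"] by (simp add: field_simps)
  have hol: "f holomorphic_on cball 0 r"
    using assms by (intro holomorphic_on_subset[OF assms(1)]) auto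
  have "((\<lambda>u. f u / (u - 0) ^ Suc k) has_contour_integral (2 * pi * \<i>) / fact k * (deriv ^^ k) f 0) (circlepath 0 r)"
    using hol assms by (intro Cauchy_has_contour_integral_higher_derivative_circlepath)
      (auto intro: holomorphic_on_imp_continuous_on holomorphic_on_subset)
  then have "((\<lambda>t. f (circlepath 0 r t) / (circlepath 0 r t) ^ Suc k * vector_derivative (circlepath 0 r) (at t within {0..1}))
     has_integral (2 * pi * \<i>) * taylor_coeff f k) {0..1}"
    by (simp add: has_contour_integral_def taylor_coeff_def field_simps)
  then have "((\<lambda>t. f (r * e t) / (r * e t) ^ Suc k * (2 * pi * \<i> * r * e t))
     has_integral (2 * pi * \<i>) * taylor_coeff f k) {0..1}"
    by (rule has_integral_eq[rotated]) (simp add: vector_derivative_circlepath01, simp add: circlepath e_def)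
  from has_integral_mult_right[OF this, of "of_real r ^ k / (2 * pi * \<i>)"]
  have "((\<lambda>t. f (r * e t) * cnj (e t ^ k)) has_integral taylor_coeff f k * r ^ k) {0..1}"
    using assms by (simp add: cnj_e field_simps)
  then show ?thesis by (simp add: e_def)
qed

lemma parseval_circle:
  fixes r :: real
  assumes "f holomorphic_on ball 0 1" "0 < r" "r < 1"
  obtains J where "((\<lambda>t. (norm (f (r * exp (2 * of_real pi * \<i> * of_real t))))\<^sup>2) has_integral J) {0..1}"
    and "(\<lambda>k. (norm (taylor_coeff f k))\<^sup>2 * (r\<^sup>2) ^ k) sums J"
proof -
  define e where "e t = exp (2 * of_real pi * \<i> * of_real t)" for t :: real
  define b where "b k = taylor_coeff f k * r ^ k" for k
  have ne [simp]: "norm (e t) = 1" for t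
    by (simp_all add: e_def norm_exp_eq_Re)
  have [continuous_intros]: "continuous_on S e" for S
    unfolding e_def by (intro continuous_intros)
  have contf: "continuous_on {0..1} (\<lambda>t. f (r * e t))"
    using assms by (intro continuous_on_compose2[OF holomorphic_on_imp_continuous_on[OF assms(1)]] continuous_intros)
      (auto simp: norm_mult)
  have "uniform_limit {0..1} (\<lambda>n t. \<Sum>k<n. b k * e t ^ k) (\<lambda>t. suminf (\<lambda>k. b k * e t ^ k)) sequentially"
    using assms taylor_coeff_abs_summable[OF assms(1), of r]
    by (intro Weierstrass_m_test[where M = "\<lambda>k. norm (b k)"])
       (auto simp: b_def norm_mult norm_power)
  moreover have "suminf (\<lambda>k. b k * e t ^ k) = f (r * e t)" for t
    using taylor_coeff_sums[OF assms(1), of "r * e t"] assms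
    by (intro sums_unique[symmetric]) (simp add: b_def norm_mult power_mult_distrib mult.assoc)
  ultimately have ul: "uniform_limit {0..1} (\<lambda>n t. \<Sum>k<n. b k * e t ^ k) (\<lambda>t. f (r * e t)) sequentially"
    by simp
  have "compact ((\<lambda>t. f (r * e t)) ` {0..1})"
    by (intro compact_continuous_image contf) auto
  then have bdd: "bounded ((\<lambda>t. f (r * e t)) ` {0..1})"
    by (rule compact_imp_bounded)
  then have bdd': "bounded ((\<lambda>t. cnj (f (r * e t))) ` {0..1})"
    by (auto simp: bounded_iff)
  have ul': "uniform_limit {0..1} (\<lambda>n t. (\<Sum>k<n. b k * e t ^ k) * cnj (f (r * e t)))
      (\<lambda>t. f (r * e t) * cnj (f (r * e t))) sequentially"
    by (intro bounded_bilinear.bounded_uniform_limit[OF bounded_bilinear_mult] ul bdd bdd' uniform_limit_const)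
  obtain I J where IJ: "\<And>n. ((\<lambda>t. (\<Sum>k<n. b k * e t ^ k) * cnj (f (r * e t))) has_integral I n) {0..1}"
     "((\<lambda>t. f (r * e t) * cnj (f (r * e t))) has_integral J) {0..1}" "I \<longlonglongrightarrow> J"
    by (rule uniform_limit_integral[OF ul']) (auto intro!: continuous_intros contf)
  have "I n = (\<Sum>k<n. of_real ((norm (b k))\<^sup>2))" for n
  proof (rule has_integral_unique[OF IJ(1)])
    have "((\<lambda>t. b k * e t ^ k * cnj (f (r * e t))) has_integral of_real ((norm (b k))\<^sup>2)) {0..1}" for k
    proof -
      have "((\<lambda>t. cnj (f (r * e t) * cnj (e t ^ k))) has_integral cnj (b k)) {0..1}"
        using has_integral_cnj[THEN iffD2, OF taylor_coeff_integral[OF assms, of k]]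
        by (simp add: b_def e_def o_def)
      from has_integral_mult_right[OF this, of "b k"]
      show ?thesis by (simp add: mult_ac complex_norm_square flip: of_real_power)
    qed
    then show "((\<lambda>t. (\<Sum>k<n. b k * e t ^ k) * cnj (f (r * e t))) has_integral (\<Sum>k<n. of_real ((norm (b k))\<^sup>2))) {0..1}"
      unfolding sum_distrib_right by (intro has_integral_sum) auto
  qed
  then have "I = (\<lambda>n. \<Sum>k<n. of_real ((norm (b k))\<^sup>2))"
    by blast
  then have "(\<lambda>k. of_real ((norm (b k))\<^sup>2)) sums J"
    using IJ(3) by (simp only: sums_def)
  then have "(\<lambda>k. (norm (b k))\<^sup>2) sums Re J"
    using sums_Re by fastforce
  moreover have "((\<lambda>t. Re (f (r * e t) * cnj (f (r * e t)))) has_integral Re J) {0..1}"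
    using has_integral_linear[OF IJ(2) bounded_linear_Re] by (simp add: o_def)
  moreover have "Re (z * cnj z) = (norm z)\<^sup>2" for z
    by (simp add: complex_norm_square[symmetric] flip: of_real_power)
  moreover have "(norm (b k))\<^sup>2 = (norm (taylor_coeff f k))\<^sup>2 * (r\<^sup>2) ^ k" for k
    using assms by (simp add: b_def norm_mult norm_power power_mult_distrib power_mult[symmetric] mult.commute)
  ultimately show ?thesis
    by (intro that[of "Re J"]) (simp_all add: e_def)
qed

lemma Schwarz_Lemma_le:
  assumes "f holomorphic_on ball 0 1" "f 0 = 0" "\<And>z. norm z < 1 \<Longrightarrow> norm (f z) \<le> 1" "norm z < 1"
  shows "norm (f z) \<le> norm z"
proof (rule field_le_mult_one_interval)
  fix c :: real assume c: "0 < c" "c < 1"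
  have "norm (of_real c * f w) < 1" if "norm w < 1" for w
    using order.strict_trans1[OF mult_left_mono[OF assms(3)[OF that], of c], of 1] c by (simp add: norm_mult)
  then have "norm (of_real c * f z) \<le> norm z"
    by (intro Schwarz_Lemma(1)) (use assms in \<open>auto intro!: holomorphic_intros\<close>)
  then show "c * norm (f z) \<le> norm z" using c by (simp add: norm_mult)
qed

lemma norm_sub_le_norm_one_sub_cnj_mult:
  assumes "norm a \<le> 1" "norm w \<le> 1"
  shows "norm (w - a) \<le> norm (1 - cnj a * w)"
proof (rule power2_le_imp_le)
  have "(norm (1 - cnj a * w))\<^sup>2 - (norm (w - a))\<^sup>2 = (1 - (norm a)\<^sup>2) * (1 - (norm w)\<^sup>2)"
    unfolding cmod_power2 by (simp add: algebra_simps power2_eq_square)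
  moreover have "\<dots> \<ge> 0"
    using assms by (intro mult_nonneg_nonneg) (auto simp: power_le_one)
  ultimately show "(norm (w - a))\<^sup>2 \<le> (norm (1 - cnj a * w))\<^sup>2" by linarith
qed auto

lemma taylor_coeff_0: "taylor_coeff f 0 = f 0"
  by (simp add: taylor_coeff_def)

lemma taylor_coeff_l2_bound_less_1:
  assumes f: "bohr_admissible f" and a: "norm (f 0) < 1" and \<rho>: "0 < \<rho>" "\<rho> < 1"
  shows "(\<Sum>k<n. (norm (taylor_coeff f (Suc k)))\<^sup>2 * \<rho> ^ Suc k)
           \<le> \<rho> * (1 - (norm (f 0))\<^sup>2)\<^sup>2 / (1 - (norm (f 0))\<^sup>2 * \<rho>)"
proof -
  define a where "a = norm (f 0)"
  define r where "r = sqrt \<rho>"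
  define F where "F z = f z - f 0" for z
  define G where "G z = (1 - a\<^sup>2) - cnj (f 0) * F z" for z
  have r: "0 < r" "r < 1" "r\<^sup>2 = \<rho>"
    using \<rho> by (auto simp: r_def)
  have a01: "0 \<le> a" "a < 1" "a\<^sup>2 < 1"
    using a by (auto simp: a_def power_less_one_iff)
  have hol: "f holomorphic_on ball 0 1" and le1: "\<And>z. norm z < 1 \<Longrightarrow> norm (f z) \<le> 1"
    using f by (auto simp: bohr_admissible_def)
  have holF: "F holomorphic_on ball 0 1" and holG: "G holomorphic_on ball 0 1"
    unfolding G_def F_def by (intro holomorphic_intros hol)+
  have G_eq: "G z = 1 - cnj (f 0) * f z" for z
    using complex_norm_square[of "f 0"] by (simp add: G_def F_def a_def algebra_simps)
  have G_nz: "G z \<noteq> 0" if "norm z < 1" for z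
  proof -
    have "norm (cnj (f 0) * f z) \<le> a * 1"
      unfolding norm_mult using le1[OF that] by (intro mult_mono) (auto simp: a_def)
    then show ?thesis using a01 by (auto simp: G_eq)
  qed
  have FG: "norm (F z) \<le> norm z * norm (G z)" if z: "norm z < 1" for z
  proof -
    have "norm (F z / G z) \<le> norm z"
    proof (rule Schwarz_Lemma_le[where f = "\<lambda>z. F z / G z"])
      show "(\<lambda>z. F z / G z) holomorphic_on ball 0 1"
        using G_nz by (intro holomorphic_intros holF holG) auto
      show "norm (F z / G z) \<le> 1" if "norm z < 1" for z
        using norm_sub_le_norm_one_sub_cnj_mult[of "f 0" "f z"] le1[OF that] le1[of 0] G_nz[OF that]
        by (simp add: norm_divide F_def G_eq)
    qed (use z in \<open>auto simp: F_def\<close>)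
    then show ?thesis using G_nz[OF z] by (simp add: norm_divide field_simps)
  qed
  have sF: "(\<lambda>k. (if k = 0 then 0 else taylor_coeff f k) * z ^ k) sums F z" if "norm z < 1" for z
  proof -
    have "(\<lambda>k. taylor_coeff f k * z ^ k - (if k = 0 then f 0 else 0)) sums (f z - f 0)"
      by (intro sums_diff taylor_coeff_sums hol that sums_single)
    then show ?thesis
      unfolding F_def by (rule sums_cong[THEN iffD1, rotated]) (auto simp: taylor_coeff_0)
  qed
  have sG: "(\<lambda>k. (if k = 0 then 1 - a\<^sup>2 else - cnj (f 0) * taylor_coeff f k) * z ^ k) sums G z"
    if "norm z < 1" for z
  proof -
    have "(\<lambda>k. (if k = 0 then of_real (1 - a\<^sup>2) else 0) - cnj (f 0) * ((if k = 0 then 0 else taylor_coeff f k) * z ^ k)) sums G z"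
      unfolding G_def by (intro sums_diff sums_mult sF that sums_single)
    then show ?thesis
      by (rule sums_cong[THEN iffD1, rotated]) auto
  qed
  note cF = taylor_coeff_eqI[OF sF] and cG = taylor_coeff_eqI[OF sG]
  obtain J where J: "((\<lambda>t. (norm (F (r * exp (2 * of_real pi * \<i> * of_real t))))\<^sup>2) has_integral J) {0..1}"
      "(\<lambda>k. (norm (taylor_coeff F k))\<^sup>2 * (r\<^sup>2) ^ k) sums J"
    using parseval_circle[OF holF r(1,2)] by blast
  obtain K where K: "((\<lambda>t. (norm (G (r * exp (2 * of_real pi * \<i> * of_real t))))\<^sup>2) has_integral K) {0..1}"
      "(\<lambda>k. (norm (taylor_coeff G k))\<^sup>2 * (r\<^sup>2) ^ k) sums K"
    using parseval_circle[OF holG r(1,2)] by blast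
  have "(\<lambda>k. (if k = 0 then (1 - a\<^sup>2)\<^sup>2 else 0) + a\<^sup>2 * ((norm (taylor_coeff F k))\<^sup>2 * (r\<^sup>2) ^ k))
          sums ((1 - a\<^sup>2)\<^sup>2 + a\<^sup>2 * J)"
    by (intro sums_add sums_mult J(2) sums_single)
  moreover have "(if k = 0 then (1 - a\<^sup>2)\<^sup>2 else 0) + a\<^sup>2 * ((norm (taylor_coeff F k))\<^sup>2 * (r\<^sup>2) ^ k)
      = (norm (taylor_coeff G k))\<^sup>2 * (r\<^sup>2) ^ k" for k
  proof -
    have "norm (1 - (complex_of_real a)\<^sup>2) = \<bar>1 - a\<^sup>2\<bar>"
      using norm_of_real[of "1 - a\<^sup>2", where ?'a = complex] by simp
    then show ?thesis
      by (simp add: cF cG norm_mult a_def power_mult_distrib)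
  qed
  ultimately have KJ: "K = (1 - a\<^sup>2)\<^sup>2 + a\<^sup>2 * J"
    using K(2) sums_unique2 by simp
  have "J \<le> r\<^sup>2 * K"
  proof (rule has_integral_le[OF J(1) has_integral_mult_right[OF K(1)]])
    fix t :: real
    have "norm (r * exp (2 * of_real pi * \<i> * of_real t)) = r"
      using r by (simp add: norm_mult norm_exp_eq_Re)
    from power_mono[OF FG, of "r * exp (2 * of_real pi * \<i> * of_real t)" 2, unfolded this]
    show "(norm (F (r * exp (2 * of_real pi * \<i> * of_real t))))\<^sup>2
            \<le> r\<^sup>2 * (norm (G (r * exp (2 * of_real pi * \<i> * of_real t))))\<^sup>2"
      using r by (simp add: power_mult_distrib)
  qed
  moreover have "a\<^sup>2 * \<rho> < 1"
    using a01 \<rho> mult_strict_mono[of "a\<^sup>2" 1 \<rho> 1] by simp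
  ultimately have J_le: "J \<le> \<rho> * (1 - a\<^sup>2)\<^sup>2 / (1 - a\<^sup>2 * \<rho>)"
    by (simp add: KJ r field_simps)
  have "(\<Sum>k<n. (norm (taylor_coeff f (Suc k)))\<^sup>2 * \<rho> ^ Suc k)
      = (\<Sum>k<Suc n. (norm (taylor_coeff F k))\<^sup>2 * (r\<^sup>2) ^ k)"
    unfolding sum.lessThan_Suc_shift by (simp add: cF r)
  also have "\<dots> \<le> J"
    using sum_le_suminf[OF sums_summable[OF J(2)], of "{..<Suc n}"] sums_unique[OF J(2)] by simp
  finally show ?thesis using J_le by (simp add: a_def)
qed

lemma taylor_coeff_l2_bound:
  assumes f: "bohr_admissible f" and a: "norm (f 0) < 1" and \<rho>: "0 < \<rho>" "\<rho> \<le> 1"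
  shows "(\<Sum>k<n. (norm (taylor_coeff f (Suc k)))\<^sup>2 * \<rho> ^ Suc k)
           \<le> \<rho> * (1 - (norm (f 0))\<^sup>2)\<^sup>2 / (1 - (norm (f 0))\<^sup>2 * \<rho>)"
proof (cases "\<rho> < 1")
  case True
  then show ?thesis using taylor_coeff_l2_bound_less_1 assms by blast
next
  case False
  with \<rho> have [simp]: "\<rho> = 1" by simp
  have "(norm (f 0))\<^sup>2 < 1"
    using a by (simp add: power_less_one_iff)
  then have nz: "1 - (norm (f 0))\<^sup>2 * 1 \<noteq> 0" by simp
  have ev: "\<forall>\<^sub>F x in at_left 1. x \<in> {0<..<(1::real)}"
    by (rule eventually_at_leftI[of 0]) auto
  show ?thesis unfolding \<open>\<rho> = 1\<close>
  proof (rule tendsto_le[OF trivial_limit_at_left_real])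
    show "((\<lambda>x. \<Sum>k<n. (norm (taylor_coeff f (Suc k)))\<^sup>2 * x ^ Suc k)
       \<longlongrightarrow> (\<Sum>k<n. (norm (taylor_coeff f (Suc k)))\<^sup>2 * 1 ^ Suc k)) (at_left 1)"
      by (intro tendsto_intros)
    show "((\<lambda>x. x * (1 - (norm (f 0))\<^sup>2)\<^sup>2 / (1 - (norm (f 0))\<^sup>2 * x))
       \<longlongrightarrow> 1 * (1 - (norm (f 0))\<^sup>2)\<^sup>2 / (1 - (norm (f 0))\<^sup>2 * 1)) (at_left 1)"
      by (intro tendsto_intros nz)
    show "\<forall>\<^sub>F x in at_left 1. (\<Sum>k<n. (norm (taylor_coeff f (Suc k)))\<^sup>2 * x ^ Suc k)
        \<le> x * (1 - (norm (f 0))\<^sup>2)\<^sup>2 / (1 - (norm (f 0))\<^sup>2 * x)"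
      using ev by eventually_elim (use taylor_coeff_l2_bound_less_1[OF f a] in auto)
  qed
qed

lemma taylor_coeff_eq_0_of_norm_eq_1:
  assumes f: "bohr_admissible f" and a: "norm (f 0) = 1"
  shows "taylor_coeff f (Suc k) = 0"
proof -
  have hol: "f holomorphic_on ball 0 1" and le1: "\<And>z. norm z < 1 \<Longrightarrow> norm (f z) \<le> 1"
    using f by (auto simp: bohr_admissible_def)
  obtain J where J: "((\<lambda>t. (norm (f ((1/2::real) * exp (2 * of_real pi * \<i> * of_real t))))\<^sup>2) has_integral J) {0..1}"
      "(\<lambda>k. (norm (taylor_coeff f k))\<^sup>2 * ((1/2)\<^sup>2) ^ k) sums J"
    using parseval_circle[OF hol, of "1/2"] by auto
  have "J \<le> 1"
  proof (rule has_integral_le[OF J(1)])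
    show "((\<lambda>t. 1) has_integral (1::real)) {0..1::real}"
      using has_integral_const_real[of "1::real" 0 1] by simp
    show "(norm (f ((1/2::real) * exp (2 * of_real pi * \<i> * of_real t))))\<^sup>2 \<le> 1" for t :: real
      by (intro power_le_one le1) (auto simp: norm_mult norm_exp_eq_Re)
  qed
  moreover have "(\<Sum>k\<in>{0, Suc k}. (norm (taylor_coeff f k))\<^sup>2 * ((1/2)\<^sup>2) ^ k) \<le> J"
    using sum_le_suminf[OF sums_summable[OF J(2)], of "{0, Suc k}"] sums_unique[OF J(2)] by simp
  ultimately have "(norm (taylor_coeff f (Suc k)))\<^sup>2 * ((1/2)\<^sup>2) ^ Suc k \<le> 0"
    using a by (simp add: taylor_coeff_0)
  moreover have "0 < ((1/2::real)\<^sup>2) ^ Suc k"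
    by (intro zero_less_power) simp
  ultimately have "(norm (taylor_coeff f (Suc k)))\<^sup>2 \<le> 0"
    by (metis mult_le_0_iff not_le)
  then show ?thesis by simp
qed

lemma sum_geometric_le:
  fixes x :: real
  assumes "0 \<le> x" "x < 1"
  shows "(\<Sum>k<n. x ^ Suc k) \<le> x / (1 - x)"
proof -
  have "(\<lambda>k. x * x ^ k) sums (x * (1 / (1 - x)))"
    using assms by (intro sums_mult geometric_sums) auto
  then show ?thesis
    using assms sum_le_suminf[of "\<lambda>k. x * x ^ k" "{..<n}"] by (auto simp: sums_iff)
qed

lemma taylor_coeff_sum_le:
  assumes f: "bohr_admissible f" and a: "norm (f 0) < 1" and \<rho>: "0 < \<rho>" "\<rho> \<le> 1" and r: "0 \<le> r" "r\<^sup>2 < \<rho>"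
  shows "(\<Sum>k<n. norm (taylor_coeff f (Suc k)) * r ^ Suc k)
           \<le> (1 - (norm (f 0))\<^sup>2) * r / sqrt ((1 - (norm (f 0))\<^sup>2 * \<rho>) * (1 - r\<^sup>2 / \<rho>))"
proof -
  define a where "a = norm (f 0)"
  have a01: "0 \<le> a" "a < 1" "a\<^sup>2 < 1"
    using a by (auto simp: a_def power_less_one_iff)
  have a\<rho>: "a\<^sup>2 * \<rho> < 1"
    using a01 \<rho> mult_le_one[of \<rho> "a\<^sup>2"] mult_left_mono[of \<rho> 1 "a\<^sup>2"] by simp
  have r\<rho>: "r\<^sup>2 / \<rho> < 1" using r \<rho> by (simp add: divide_simps)
  have "(\<Sum>k<n. norm (taylor_coeff f (Suc k)) * r ^ Suc k)\<^sup>2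
      = (\<Sum>k<n. (norm (taylor_coeff f (Suc k)) * sqrt \<rho> ^ Suc k) * (r / sqrt \<rho>) ^ Suc k)\<^sup>2"
    using \<rho> by (simp add: power_divide)
  also have "\<dots> \<le> (\<Sum>k<n. (norm (taylor_coeff f (Suc k)) * sqrt \<rho> ^ Suc k)\<^sup>2) * (\<Sum>k<n. ((r / sqrt \<rho>) ^ Suc k)\<^sup>2)"
    by (rule Cauchy_Schwarz_ineq_sum)
  also have "(\<lambda>k. (norm (taylor_coeff f (Suc k)) * sqrt \<rho> ^ Suc k)\<^sup>2) = (\<lambda>k. (norm (taylor_coeff f (Suc k)))\<^sup>2 * \<rho> ^ Suc k)"
    using \<rho> by (auto simp: power_mult_distrib simp flip: real_sqrt_power)
  also have "(\<lambda>k. ((r / sqrt \<rho>) ^ Suc k)\<^sup>2) = (\<lambda>k. (r\<^sup>2 / \<rho>) ^ Suc k)"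
  proof
    fix k
    have "((r / sqrt \<rho>) ^ Suc k)\<^sup>2 = ((r / sqrt \<rho>)\<^sup>2) ^ Suc k"
      by (metis power_commutes power_mult mult.commute)
    then show "((r / sqrt \<rho>) ^ Suc k)\<^sup>2 = (r\<^sup>2 / \<rho>) ^ Suc k"
      using \<rho> by (simp add: power_divide)
  qed
  also have "(\<Sum>k<n. (norm (taylor_coeff f (Suc k)))\<^sup>2 * \<rho> ^ Suc k) * (\<Sum>k<n. (r\<^sup>2 / \<rho>) ^ Suc k)
      \<le> (\<rho> * (1 - a\<^sup>2)\<^sup>2 / (1 - a\<^sup>2 * \<rho>)) * ((r\<^sup>2 / \<rho>) / (1 - r\<^sup>2 / \<rho>))"
    using taylor_coeff_l2_bound[OF f a \<rho>] sum_geometric_le[of "r\<^sup>2 / \<rho>"] \<rho> r\<rho> a\<rho>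
    by (intro mult_mono) (auto simp: a_def intro!: sum_nonneg divide_nonneg_nonneg mult_nonneg_nonneg)
  also have "\<dots> = (1 - a\<^sup>2)\<^sup>2 * r\<^sup>2 / ((1 - a\<^sup>2 * \<rho>) * (1 - r\<^sup>2 / \<rho>))"
    using \<rho> by (simp add: field_simps)
  also have "\<dots> = ((1 - a\<^sup>2) * r / sqrt ((1 - a\<^sup>2 * \<rho>) * (1 - r\<^sup>2 / \<rho>)))\<^sup>2"
    using a\<rho> r\<rho> by (simp add: power_divide power_mult_distrib)
  finally show ?thesis
    unfolding a_def by (rule power2_le_imp_le) (use a01 r a\<rho> r\<rho> in \<open>auto simp: a_def intro!: divide_nonneg_nonneg\<close>)
qed

lemma taylor_coeff_sum_le_of_le_norm:
  assumes f: "bohr_admissible f" and a: "norm (f 0) < 1" and r: "0 \<le> r" "r \<le> norm (f 0)"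
  shows "(\<Sum>k<n. norm (taylor_coeff f (Suc k)) * r ^ Suc k)
           \<le> (1 - (norm (f 0))\<^sup>2) * r / (1 - norm (f 0) * r)"
proof (cases "r = 0")
  case False
  define a where "a = norm (f 0)"
  have a01: "0 < a" "a < 1" "0 < r" "r \<le> a"
    using assms False by (auto simp: a_def)
  have ar: "a * r < 1" using a01 mult_strict_mono[of a 1 r 1] by simp
  have "a * r\<^sup>2 < r"
    using mult_strict_right_mono[OF ar, of r] a01 by (simp add: power2_eq_square mult_ac)
  then have "r\<^sup>2 < r / a" using a01 by (simp add: field_simps)
  moreover have "(1 - a\<^sup>2 * (r / a)) * (1 - r\<^sup>2 / (r / a)) = (1 - a * r)\<^sup>2"
    using a01 by (simp add: field_simps power2_eq_square)
  ultimately show ?thesis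
    using taylor_coeff_sum_le[OF f a, of "r / a" r n] a01 ar
    by (simp add: a_def)
qed simp

lemma taylor_coeff_sum_le_sqrt:
  assumes f: "bohr_admissible f" and a: "norm (f 0) < 1" and r: "0 \<le> r" "r < 1"
  shows "(\<Sum>k<n. norm (taylor_coeff f (Suc k)) * r ^ Suc k)
           \<le> r * sqrt (1 - (norm (f 0))\<^sup>2) / sqrt (1 - r\<^sup>2)"
proof -
  have "(norm (f 0))\<^sup>2 < 1" "r\<^sup>2 < 1" using a r by (auto simp: power_less_one_iff)
  then show ?thesis
    using taylor_coeff_sum_le[OF f a, of 1 r n] r
    by (simp add: real_sqrt_mult real_div_sqrt mult.commute[of r] flip: times_divide_eq_left divide_divide_eq_left)
qed

subsection \<open>The functions A and S\<close>

text \<open>The largest value that \<open>\<Sum>k\<ge>1. |x\<^sub>k| r ^ k\<close> may take in the Bohr inequality when \<open>|x\<^sub>0| = a\<close>.\<close>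
definition slack :: "real \<Rightarrow> real \<Rightarrow> real \<Rightarrow> real" where
  "slack p q a = (1 - a powr p) powr (1 / q)"

lemma slack_nonneg: "0 \<le> slack p q a"
  by (simp add: slack_def)

lemma powr_less_one_of_less_one:
  fixes a p :: real
  assumes "0 < p" "0 \<le> a" "a < 1"
  shows "a powr p < 1"
  using powr_less_mono2[OF assms(1,2,3)] by simp

lemma slack_pos: "0 < p \<Longrightarrow> 0 \<le> a \<Longrightarrow> a < 1 \<Longrightarrow> 0 < slack p q a"
  using powr_less_one_of_less_one[of p a] by (simp add: slack_def)

lemma slack_le_1: "0 < p \<Longrightarrow> 0 < q \<Longrightarrow> 0 \<le> a \<Longrightarrow> a < 1 \<Longrightarrow> slack p q a \<le> 1"
  using powr_less_one_of_less_one[of p a] by (auto simp: slack_def intro!: powr_le1)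

lemma slack_powr:
  assumes "0 < q" "0 < p" "0 \<le> a" "a \<le> 1"
  shows "slack p q a powr q = 1 - a powr p"
proof -
  have "a powr p \<le> 1" using assms by (intro powr_le1) auto
  then show ?thesis using assms by (simp add: slack_def powr_powr)
qed

lemma A_pq_slack: "A_pq p q a = slack p q a / (1 - a\<^sup>2 + a * slack p q a)"
  by (simp add: A_pq_def slack_def)

lemma S_pq_slack: "S_pq p q a = sqrt ((slack p q a)\<^sup>2 / (1 - a\<^sup>2 + (slack p q a)\<^sup>2))"
proof -
  have "(slack p q a)\<^sup>2 = (1 - a powr p) powr (2 / q)"
    by (cases "1 - a powr p = 0") (auto simp: slack_def powr_power)
  then show ?thesis by (simp add: S_pq_def)
qed

lemma sq_less_1: "0 \<le> a \<Longrightarrow> a < 1 \<Longrightarrow> (a::real)\<^sup>2 < 1"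
  by (simp add: power_less_one_iff)

lemma mult_less_1_real:
  fixes a s :: real
  assumes "0 \<le> a" "a < 1" "s \<le> 1"
  shows "a * s < 1"
  using mult_left_mono[OF assms(3,1)] assms(2) by simp

lemma le_S_pq_iff:
  assumes "0 \<le> c" "0 \<le> a" "a < 1"
  shows "c \<le> S_pq p q a \<longleftrightarrow> c\<^sup>2 * (1 - a\<^sup>2) \<le> (slack p q a)\<^sup>2 * (1 - c\<^sup>2)"
proof -
  have "0 < 1 - a\<^sup>2 + (slack p q a)\<^sup>2"
    using sq_less_1[of a] assms by (simp add: add_pos_nonneg)
  have "c \<le> S_pq p q a \<longleftrightarrow> sqrt (c\<^sup>2) \<le> S_pq p q a"
    using assms by simp
  also have "\<dots> \<longleftrightarrow> c\<^sup>2 \<le> (slack p q a)\<^sup>2 / (1 - a\<^sup>2 + (slack p q a)\<^sup>2)"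
    unfolding S_pq_slack by (rule real_sqrt_le_iff)
  also have "\<dots> \<longleftrightarrow> c\<^sup>2 * (1 - a\<^sup>2) \<le> (slack p q a)\<^sup>2 * (1 - c\<^sup>2)"
    using \<open>0 < 1 - a\<^sup>2 + (slack p q a)\<^sup>2\<close> by (simp add: pos_le_divide_eq algebra_simps)
  finally show ?thesis .
qed

lemma A_pq_denominator_pos:
  assumes "0 \<le> a" "a < 1"
  shows "0 < 1 - a\<^sup>2 + a * slack p q a"
  using sq_less_1[OF assms] assms slack_nonneg[of p q a] by (simp add: add_pos_nonneg)

lemma A_pq_pos: "0 < p \<Longrightarrow> 0 \<le> a \<Longrightarrow> a < 1 \<Longrightarrow> 0 < A_pq p q a"
  unfolding A_pq_slack by (intro divide_pos_pos slack_pos A_pq_denominator_pos)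

lemma A_pq_less_1:
  assumes "0 < p" "0 < q" "0 < a" "a < 1"
  shows "A_pq p q a < 1"
proof -
  have "slack p q a * (1 - a) \<le> 1 * (1 - a)"
    using assms by (intro mult_right_mono slack_le_1) auto
  also have "\<dots> < (1 + a) * (1 - a)"
    using assms by (intro mult_strict_right_mono) auto
  finally have "slack p q a < 1 - a\<^sup>2 + a * slack p q a"
    by (simp add: algebra_simps power2_eq_square)
  then show ?thesis
    using A_pq_denominator_pos[of a p q] assms by (simp add: A_pq_slack)
qed

lemma le_A_pq_iff:
  assumes "0 \<le> a" "a < 1"
  shows "r \<le> A_pq p q a \<longleftrightarrow> (1 - a\<^sup>2) * r \<le> slack p q a * (1 - a * r)"
  using A_pq_denominator_pos[OF assms, of p q]
  by (simp add: A_pq_slack pos_le_divide_eq algebra_simps)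

lemma A_pq_le_self:
  assumes "0 \<le> a" "a < 1" "slack p q a \<le> a"
  shows "A_pq p q a \<le> a"
proof -
  have "slack p q a * (1 - a\<^sup>2) \<le> a * (1 - a\<^sup>2)"
    using assms sq_less_1[of a] by (intro mult_right_mono) auto
  then show ?thesis
    using A_pq_denominator_pos[OF assms(1,2), of p q]
    by (simp add: A_pq_slack pos_divide_le_eq algebra_simps power2_eq_square)
qed

subsection \<open>Bounds for the Bohr radius\<close>

lemma bohr_radius_f_ge:
  assumes f: "bohr_admissible f" and pq: "0 < p" "0 < q" and c: "0 \<le> c" "c \<le> 1"
    and H: "norm (f 0) < 1 \<Longrightarrow> c \<le> S_pq p q (norm (f 0)) \<or> c \<le> A_pq p q (norm (f 0)) \<and> c \<le> norm (f 0)"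
  shows "ereal c \<le> bohr_radius_f p q f"
  unfolding bohr_radius_f_def
proof (rule Sup_upper, intro CollectI exI[of _ c] conjI allI impI refl)
  define a where "a = norm (f 0)"
  fix z :: complex assume z: "norm z < c"
  define r where "r = norm z"
  have r: "0 \<le> r" "r < c" "r < 1" using z c by (auto simp: r_def)
  have a01: "0 \<le> a" "a \<le> 1" using f by (auto simp: a_def bohr_admissible_def)
  have le: "(\<Sum>k<n. norm (taylor_coeff f (Suc k)) * r ^ Suc k) \<le> slack p q a" for n
  proof (cases "a < 1")
    case False
    then have "norm (f 0) = 1" using a01 by (simp add: a_def)
    then show ?thesis
      by (simp add: taylor_coeff_eq_0_of_norm_eq_1[OF f] slack_nonneg)
  next
    case a1: True
    have sq: "a\<^sup>2 < 1" "r\<^sup>2 < 1" using a1 a01 r by (auto intro: sq_less_1)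
    consider "c \<le> S_pq p q a" | "c \<le> A_pq p q a" "c \<le> a"
      using H a1 by (auto simp: a_def)
    then show ?thesis
    proof cases
      case 1
      then have "r\<^sup>2 * (1 - a\<^sup>2) \<le> (slack p q a)\<^sup>2 * (1 - r\<^sup>2)"
        using r a01 a1 by (subst le_S_pq_iff[symmetric]) auto
      then have "sqrt (r\<^sup>2 * (1 - a\<^sup>2)) \<le> sqrt ((slack p q a)\<^sup>2 * (1 - r\<^sup>2))"
        by (rule real_sqrt_le_mono)
      then have "r * sqrt (1 - a\<^sup>2) / sqrt (1 - r\<^sup>2) \<le> slack p q a"
        using sq r slack_nonneg[of p q a] by (simp add: real_sqrt_mult divide_le_eq)
      then show ?thesis
        using taylor_coeff_sum_le_sqrt[OF f _ r(1,3), of n] a1 by (simp add: a_def)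
    next
      case 2
      have "(1 - a\<^sup>2) * r \<le> slack p q a * (1 - a * r)"
        using 2 r a01 a1 by (subst le_A_pq_iff[symmetric]) auto
      moreover have "a * r < 1"
        using a01 a1 r by (intro mult_less_1_real) auto
      ultimately have "(1 - a\<^sup>2) * r / (1 - a * r) \<le> slack p q a"
        by (simp add: divide_le_eq)
      then show ?thesis
        using taylor_coeff_sum_le_of_le_norm[OF f _ r(1), of n] a1 2 r by (simp add: a_def)
    qed
  qed
  show sm: "summable (\<lambda>k. norm (taylor_coeff f (Suc k)) * norm z ^ Suc k)"
    using le unfolding r_def by (intro summableI_nonneg_bounded[where x = "slack p q a"]) auto
  have "(\<Sum>k. norm (taylor_coeff f (Suc k)) * norm z ^ Suc k) \<le> slack p q a"
    using le unfolding r_def by (intro suminf_le_const sm) auto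
  moreover have "0 \<le> (\<Sum>k. norm (taylor_coeff f (Suc k)) * norm z ^ Suc k)"
    by (intro suminf_nonneg sm) auto
  ultimately have "(\<Sum>k. norm (taylor_coeff f (Suc k)) * norm z ^ Suc k) powr q \<le> slack p q a powr q"
    using pq by (intro powr_mono2) auto
  also have "\<dots> = 1 - a powr p"
    using pq a01 by (intro slack_powr) auto
  finally show "norm (taylor_coeff f 0) powr p + (\<Sum>k. norm (taylor_coeff f (Suc k)) * norm z ^ Suc k) powr q \<le> 1"
    by (simp add: taylor_coeff_0 a_def)
qed (use c in auto)

lemma bohr_radius_C_ge:
  assumes "0 < p" "0 < q" "0 \<le> c" "c \<le> 1"
    and "\<And>a. 0 \<le> a \<Longrightarrow> a < 1 \<Longrightarrow> c \<le> S_pq p q a \<or> c \<le> A_pq p q a \<and> c \<le> a"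
  shows "ereal c \<le> bohr_radius_C p q"
  unfolding bohr_radius_C_def
proof (rule Inf_greatest, safe)
  fix f assume "bohr_admissible f"
  then show "ereal c \<le> bohr_radius_f p q f"
    by (rule bohr_radius_f_ge) (use assms in auto)
qed

lemma bohr_radius_C_le:
  assumes f: "bohr_admissible f" and c: "0 \<le> c" "c < 1"
    and V: "\<And>s. c < s \<Longrightarrow> s < 1 \<Longrightarrow> (\<lambda>k. norm (taylor_coeff f (Suc k)) * s ^ Suc k) sums V s"
    and gt: "\<And>s. c < s \<Longrightarrow> s < 1 \<Longrightarrow> 1 < norm (f 0) powr p + V s powr q"
  shows "bohr_radius_C p q \<le> ereal c"
proof -
  have "bohr_radius_C p q \<le> bohr_radius_f p q f"
    unfolding bohr_radius_C_def using f by (intro Inf_lower) auto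
  also have "bohr_radius_f p q f \<le> ereal c"
    unfolding bohr_radius_f_def
  proof (rule Sup_least, safe)
    fix r :: real
    assume *: "\<forall>z::complex. norm z < r \<longrightarrow>
         summable (\<lambda>k. norm (taylor_coeff f (Suc k)) * norm z ^ Suc k) \<and>
         norm (taylor_coeff f 0) powr p
           + (\<Sum>k. norm (taylor_coeff f (Suc k)) * norm z ^ Suc k) powr q \<le> 1"
    show "ereal r \<le> ereal c"
    proof (rule ccontr)
      assume "\<not> ereal r \<le> ereal c"
      then obtain s where s: "c < s" "s < min r 1"
        using dense[of c "min r 1"] c by auto
      have "norm (taylor_coeff f 0) powr p + V s powr q \<le> 1"
        using *[rule_format, of "of_real s"] s c sums_unique[OF V[of s]] by simp
      then show False
        using gt[of s] s by (simp add: taylor_coeff_0)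
    qed
  qed
  finally show ?thesis .
qed

definition moebius_coeff :: "real \<Rightarrow> nat \<Rightarrow> complex" where
  "moebius_coeff a k = (case k of 0 \<Rightarrow> of_real a | Suc j \<Rightarrow> of_real ((a\<^sup>2 - 1) * a ^ j))"

lemma one_minus_mult_nonzero:
  assumes "0 \<le> a" "a < 1" "norm z < 1"
  shows "1 - of_real a * z \<noteq> (0::complex)"
proof -
  have "norm (of_real a * z) < 1"
    using assms mult_left_mono[of "norm z" 1 a] by (simp add: norm_mult)
  then show ?thesis by auto
qed

lemma moebius_coeff_sums:
  assumes "0 \<le> a" "a < 1" "norm z < 1"
  shows "(\<lambda>k. moebius_coeff a k * z ^ k) sums ((of_real a - z) / (1 - of_real a * z))"
proof -
  have "norm (of_real a * z) < 1"
    using assms mult_left_mono[of "norm z" 1 a] by (simp add: norm_mult)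
  then have "(\<lambda>k. (of_real a ^ 2 - 1) * z * (of_real a * z) ^ k) sums
          ((of_real a ^ 2 - 1) * z * (1 / (1 - of_real a * z)))"
    by (intro sums_mult geometric_sums)
  then have "(\<lambda>k. moebius_coeff a (Suc k) * z ^ Suc k) sums
          ((of_real a ^ 2 - 1) * z * (1 / (1 - of_real a * z)))"
    by (simp add: moebius_coeff_def power_mult_distrib mult_ac)
  from sums_Suc[of "\<lambda>k. moebius_coeff a k * z ^ k", OF this] show ?thesis
    by (rule back_subst[of "(sums) _"])
      (use one_minus_mult_nonzero[OF assms] in \<open>simp add: moebius_coeff_def field_simps power2_eq_square\<close>)
qed

lemma moebius_admissible:
  assumes "0 \<le> a" "a < 1"
  shows "bohr_admissible (\<lambda>z. (of_real a - z) / (1 - of_real a * z))"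
  unfolding bohr_admissible_def
proof (intro conjI ballI)
  show "(\<lambda>z. (of_real a - z) / (1 - of_real a * z)) holomorphic_on ball 0 1"
    using one_minus_mult_nonzero[OF assms] by (intro holomorphic_intros) auto
  fix z :: complex assume "z \<in> ball 0 1"
  then show "norm ((of_real a - z) / (1 - of_real a * z)) \<le> 1"
    using norm_sub_le_norm_one_sub_cnj_mult[of "of_real a" z] one_minus_mult_nonzero[OF assms, of z] assms
    by (simp add: norm_divide norm_minus_commute)
qed

lemma moebius_coeff_norm_sums:
  assumes "0 \<le> a" "a < 1" "0 \<le> s" "s < 1"
  shows "(\<lambda>k. norm (moebius_coeff a (Suc k)) * s ^ Suc k) sums ((1 - a\<^sup>2) * s / (1 - a * s))"
proof -
  have "a * s < 1"
    using assms by (intro mult_less_1_real) auto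
  then have "(\<lambda>k. (1 - a\<^sup>2) * s * (a * s) ^ k) sums ((1 - a\<^sup>2) * s * (1 / (1 - a * s)))"
    using assms by (intro sums_mult geometric_sums) auto
  moreover have "norm (moebius_coeff a (Suc k)) = (1 - a\<^sup>2) * a ^ k" for k
    unfolding moebius_coeff_def using assms sq_less_1[of a]
    by (simp add: abs_mult del: of_real_mult of_real_diff of_real_power)
  ultimately show ?thesis by (simp add: power_mult_distrib mult_ac)
qed

lemma bohr_radius_C_le_A_pq:
  assumes "0 < p" "0 < q" "0 < a" "a < 1"
  shows "bohr_radius_C p q \<le> ereal (A_pq p q a)"
proof (rule bohr_radius_C_le[OF moebius_admissible[of a]])
  show "0 \<le> A_pq p q a" "A_pq p q a < 1"
    using A_pq_pos[of p a q] A_pq_less_1[of p q a] assms by auto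
  fix s assume s: "A_pq p q a < s" "s < 1"
  then have s0: "0 < s" using A_pq_pos[of p a q] assms by auto
  show "(\<lambda>k. norm (taylor_coeff (\<lambda>z. (of_real a - z) / (1 - of_real a * z)) (Suc k)) * s ^ Suc k)
         sums ((1 - a\<^sup>2) * s / (1 - a * s))"
    using moebius_coeff_norm_sums[of a s] s s0 assms
    by (simp add: taylor_coeff_eqI[OF moebius_coeff_sums])
  have "a * s < 1"
    using assms s by (intro mult_less_1_real) auto
  moreover have "slack p q a * (1 - a * s) < (1 - a\<^sup>2) * s"
    using le_A_pq_iff[of a s p q] s assms by auto
  ultimately have "slack p q a < (1 - a\<^sup>2) * s / (1 - a * s)"
    by (simp add: less_divide_eq)
  then have "slack p q a powr q < ((1 - a\<^sup>2) * s / (1 - a * s)) powr q"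
    using assms slack_nonneg by (intro powr_less_mono2) auto
  then show "1 < norm ((of_real a - 0) / (1 - of_real a * 0) :: complex) powr p + ((1 - a\<^sup>2) * s / (1 - a * s)) powr q"
    using assms by (simp add: slack_powr)
qed (use assms in auto)

lemma bohr_radius_C_le_inverse_sqrt_2:
  assumes "0 < p" "0 < q"
  shows "bohr_radius_C p q \<le> ereal (1 / sqrt 2)"
proof -
  define a :: real where "a = 1 / sqrt 2"
  have a2: "a\<^sup>2 = 1 / 2" by (simp add: a_def power_divide)
  have a01: "0 < a" "a < 1" by (auto simp: a_def)
  define f where "f z = z * ((of_real a - z) / (1 - of_real a * z))" for z :: complex
  have "bohr_admissible f"
    unfolding bohr_admissible_def
  proof (intro conjI ballI)
    have adm: "bohr_admissible (\<lambda>z. (of_real a - z) / (1 - of_real a * z))"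
      using moebius_admissible a01 by simp
    then show "f holomorphic_on ball 0 1"
      unfolding f_def bohr_admissible_def by (intro holomorphic_on_mult holomorphic_on_ident) auto
    fix z :: complex assume "z \<in> ball 0 1"
    then show "norm (f z) \<le> 1"
      using adm unfolding f_def bohr_admissible_def norm_mult by (intro mult_le_one) auto
  qed
  have coeff: "taylor_coeff f k = (case k of 0 \<Rightarrow> 0 | Suc j \<Rightarrow> moebius_coeff a j)" for k
  proof (rule taylor_coeff_eqI)
    fix z :: complex assume z: "norm z < 1"
    have "(\<lambda>k. z * (moebius_coeff a k * z ^ k)) sums f z"
      unfolding f_def using a01 z by (intro sums_mult moebius_coeff_sums) auto
    then have "(\<lambda>k. (case Suc k of 0 \<Rightarrow> 0 | Suc j \<Rightarrow> moebius_coeff a j) * z ^ Suc k) sums f z"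
      by (simp add: mult_ac)
    from sums_Suc[of "\<lambda>k. (case k of 0 \<Rightarrow> 0 | Suc j \<Rightarrow> moebius_coeff a j) * z ^ k", OF this]
    show "(\<lambda>k. (case k of 0 \<Rightarrow> 0 | Suc j \<Rightarrow> moebius_coeff a j) * z ^ k) sums f z"
      by simp
  qed
  have "bohr_radius_C p q \<le> ereal a"
  proof (rule bohr_radius_C_le[OF \<open>bohr_admissible f\<close>])
    fix s assume s: "a < s" "s < 1"
    have "(\<lambda>k. norm (moebius_coeff a k) * s ^ k) sums
           ((1 - a\<^sup>2) * s / (1 - a * s) + norm (moebius_coeff a 0) * s ^ 0)"
      using a01 s by (intro sums_Suc moebius_coeff_norm_sums) auto
    then have "(\<lambda>k. norm (moebius_coeff a k) * s ^ k) sums ((1 - a\<^sup>2) * s / (1 - a * s) + a)"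
      using a01 by (simp add: moebius_coeff_def)
    from sums_mult[OF this, of s]
    show "(\<lambda>k. norm (taylor_coeff f (Suc k)) * s ^ Suc k) sums (s * ((1 - a\<^sup>2) * s / (1 - a * s) + a))"
      by (simp add: coeff mult_ac)
    have as: "a * s < 1"
      using a01 s by (intro mult_less_1_real) auto
    have as': "1 / 2 < a * s"
      using mult_strict_left_mono[OF s(1) a01(1)] a2 unfolding power2_eq_square by linarith
    have s2: "s * s > 1 / 2"
      using mult_strict_mono[OF s(1) s(1)] a01 s a2 by (simp add: power2_eq_square)
    have "1 / 2 < s * ((1 - a\<^sup>2) * s / (1 - a * s))"
      using as as' s2 by (simp add: a2 less_divide_eq field_simps)
    then have "1 < s * ((1 - a\<^sup>2) * s / (1 - a * s) + a)"
      using as' unfolding distrib_left mult.commute[of s a] by linarith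
    then have "1 < (s * ((1 - a\<^sup>2) * s / (1 - a * s) + a)) powr q"
      using assms by (intro gr_one_powr)
    then show "1 < norm (f 0) powr p + (s * ((1 - a\<^sup>2) * s / (1 - a * s) + a)) powr q"
      by (simp add: f_def)
  qed (use a01 in auto)
  then show ?thesis by (simp add: a_def)
qed

subsection \<open>Monotonicity of S\<close>

lemma slack_power2_eq_exp:
  assumes "0 < p" "0 \<le> a" "a < 1"
  shows "(slack p q a)\<^sup>2 = exp ((2 / q) * ln (1 - a powr p))"
  using powr_less_one_of_less_one[OF assms] by (simp add: slack_def powr_power) (simp add: powr_def)

lemma ln_slack_ratio_deriv:
  fixes p q a :: real
  assumes "0 < p" "0 < q" "0 < a" "a < 1"
  shows "((\<lambda>a. (2 / q) * ln (1 - a powr p) - ln (1 - a\<^sup>2)) has_real_derivative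
      2 / (q * a * (1 - a powr p) * (1 - a\<^sup>2)) * (q * a\<^sup>2 * (1 - a powr p) - p * a powr p * (1 - a\<^sup>2))) (at a)"
proof -
  have "a powr p < 1" "a\<^sup>2 < 1"
    using powr_less_one_of_less_one[of p a] sq_less_1[of a] assms by auto
  moreover have "a powr (p - 1) = a powr p / a"
    using assms by (simp add: powr_diff)
  ultimately show ?thesis
    using assms by (auto intro!: derivative_eq_intros simp: divide_simps)
      (simp add: algebra_simps power2_eq_square)
qed

lemma ln_slack_ratio_continuous_on:
  fixes p q x y :: real
  assumes "0 < p" "0 \<le> x" "y < 1"
  shows "continuous_on {x..y} (\<lambda>a. (2 / q) * ln (1 - a powr p) - ln (1 - a\<^sup>2))"
proof -
  have "1 - a powr p \<noteq> 0" "1 - a\<^sup>2 \<noteq> 0" if "a \<in> {x..y}" for a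
    using powr_less_one_of_less_one[of p a] sq_less_1[of a] assms that by auto
  then show ?thesis
    using assms by (intro continuous_intros continuous_on_powr') auto
qed

lemma slack_ratio_mono:
  assumes "0 < p" "0 \<le> x" "x < 1" "0 \<le> y" "y < 1"
    and "(2 / q) * ln (1 - y powr p) - ln (1 - y\<^sup>2) \<le> (2 / q) * ln (1 - x powr p) - ln (1 - x\<^sup>2)"
  shows "(slack p q y)\<^sup>2 * (1 - x\<^sup>2) \<le> (slack p q x)\<^sup>2 * (1 - y\<^sup>2)"
proof -
  have *: "exp (ln (1 - x\<^sup>2)) = 1 - x\<^sup>2" "exp (ln (1 - y\<^sup>2)) = 1 - y\<^sup>2"
    using assms sq_less_1[of x] sq_less_1[of y] by auto
  have "(2 / q) * ln (1 - y powr p) + ln (1 - x\<^sup>2) \<le> (2 / q) * ln (1 - x powr p) + ln (1 - y\<^sup>2)"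
    using assms by linarith
  then have "exp ((2 / q) * ln (1 - y powr p)) * exp (ln (1 - x\<^sup>2))
      \<le> exp ((2 / q) * ln (1 - x powr p)) * exp (ln (1 - y\<^sup>2))"
    by (simp flip: exp_add)
  then show ?thesis
    unfolding * slack_power2_eq_exp[OF assms(1,2,3)] slack_power2_eq_exp[OF assms(1,4,5)] .
qed

lemma slack_ratio_antimono_on:
  assumes "0 < p" "0 < q" "0 \<le> x" "x \<le> y" "y < 1"
    and "\<And>a. x < a \<Longrightarrow> a < y \<Longrightarrow> q * a\<^sup>2 * (1 - a powr p) \<le> p * a powr p * (1 - a\<^sup>2)"
  shows "(slack p q y)\<^sup>2 * (1 - x\<^sup>2) \<le> (slack p q x)\<^sup>2 * (1 - y\<^sup>2)"
proof (rule slack_ratio_mono)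
  show "(2 / q) * ln (1 - y powr p) - ln (1 - y\<^sup>2) \<le> (2 / q) * ln (1 - x powr p) - ln (1 - x\<^sup>2)"
  proof (rule DERIV_nonpos_imp_decreasing_open[OF assms(4)])
    fix a assume a: "x < a" "a < y"
    then have a01: "0 < a" "a < 1" using assms by auto
    then have "a powr p < 1" "a\<^sup>2 < 1"
      using powr_less_one_of_less_one[of p a] sq_less_1[of a] assms by auto
    then have "2 / (q * a * (1 - a powr p) * (1 - a\<^sup>2)) * (q * a\<^sup>2 * (1 - a powr p) - p * a powr p * (1 - a\<^sup>2)) \<le> 0"
      using assms(2) assms(6)[OF a] a01 by (intro mult_nonneg_nonpos) auto
    then show "\<exists>d. ((\<lambda>a. (2 / q) * ln (1 - a powr p) - ln (1 - a\<^sup>2)) has_real_derivative d) (at a) \<and> d \<le> 0"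
      using ln_slack_ratio_deriv[OF assms(1,2) a01] by blast
  qed (use assms ln_slack_ratio_continuous_on in auto)
qed (use assms in auto)

lemma slack_ratio_mono_on:
  assumes "0 < p" "0 < q" "0 \<le> x" "x \<le> y" "y < 1"
    and "\<And>a. x < a \<Longrightarrow> a < y \<Longrightarrow> p * a powr p * (1 - a\<^sup>2) \<le> q * a\<^sup>2 * (1 - a powr p)"
  shows "(slack p q x)\<^sup>2 * (1 - y\<^sup>2) \<le> (slack p q y)\<^sup>2 * (1 - x\<^sup>2)"
proof (rule slack_ratio_mono)
  show "(2 / q) * ln (1 - x powr p) - ln (1 - x\<^sup>2) \<le> (2 / q) * ln (1 - y powr p) - ln (1 - y\<^sup>2)"
  proof (rule DERIV_nonneg_imp_increasing_open[OF assms(4)])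
    fix a assume a: "x < a" "a < y"
    then have a01: "0 < a" "a < 1" using assms by auto
    then have "a powr p < 1" "a\<^sup>2 < 1"
      using powr_less_one_of_less_one[of p a] sq_less_1[of a] assms by auto
    then have "0 \<le> 2 / (q * a * (1 - a powr p) * (1 - a\<^sup>2)) * (q * a\<^sup>2 * (1 - a powr p) - p * a powr p * (1 - a\<^sup>2))"
      using assms(2) assms(6)[OF a] a01 by (intro mult_nonneg_nonneg) auto
    then show "\<exists>d. ((\<lambda>a. (2 / q) * ln (1 - a powr p) - ln (1 - a\<^sup>2)) has_real_derivative d) (at a) \<and> 0 \<le> d"
      using ln_slack_ratio_deriv[OF assms(1,2) a01] by blast
  qed (use assms ln_slack_ratio_continuous_on in auto)
qed (use assms in auto)

lemma powr_slope_mono: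
  fixes X Y \<theta> :: real
  assumes "1 \<le> \<theta>" "1 < Y" "Y \<le> X"
  shows "(Y powr \<theta> - 1) * (X - 1) \<le> (X powr \<theta> - 1) * (Y - 1)"
proof -
  define l where "l = (Y - 1) / (X - 1)"
  have l: "0 \<le> l" "l \<le> 1" "l * (X - 1) = Y - 1"
    using assms by (auto simp: l_def divide_simps)
  have "((1 - l) *\<^sub>R 1 + l *\<^sub>R X) powr \<theta> \<le> (1 - l) * 1 powr \<theta> + l * X powr \<theta>"
    using l assms by (intro convex_onD[OF powr_convex]) auto
  moreover have "(1 - l) *\<^sub>R 1 + l *\<^sub>R X = Y"
    using l(3) by (simp add: algebra_simps)
  ultimately have "Y powr \<theta> - 1 \<le> l * (X powr \<theta> - 1)"
    by (simp add: algebra_simps)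
  then have "(Y powr \<theta> - 1) * (X - 1) \<le> l * (X powr \<theta> - 1) * (X - 1)"
    using assms by (intro mult_right_mono) auto
  also have "\<dots> = (X powr \<theta> - 1) * (l * (X - 1))"
    by (simp only: mult_ac)
  finally show ?thesis unfolding l(3) .
qed

lemma bernoulli_powr:
  fixes X \<theta> :: real
  assumes "1 \<le> \<theta>" "1 \<le> X"
  shows "\<theta> * (X - 1) \<le> X powr \<theta> - 1"
proof -
  have "1 powr \<theta> - 1 - \<theta> * (1 - 1) \<le> X powr \<theta> - 1 - \<theta> * (X - 1)"
  proof (rule DERIV_nonneg_imp_nondecreasing[OF assms(2)], intro exI conjI)
    fix x assume x: "1 \<le> x" "x \<le> X"
    show "((\<lambda>X. X powr \<theta> - 1 - \<theta> * (X - 1)) has_real_derivative \<theta> * (x powr (\<theta> - 1) - 1)) (at x)"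
      using x by (auto intro!: derivative_eq_intros simp: algebra_simps)
    show "0 \<le> \<theta> * (x powr (\<theta> - 1) - 1)"
      using x assms by (auto intro!: mult_nonneg_nonneg ge_one_powr_ge_zero)
  qed
  then show ?thesis by simp
qed

text \<open>By \<open>ln_slack_ratio_deriv\<close>, the inequality below says that \<open>(slack p q a)\<^sup>2 / (1 - a\<^sup>2)\<close>, and hence \<open>S_pq p q a\<close>, is decreasing at \<open>a\<close>. In the
  second form it compares \<open>q / p\<close> with \<open>(a powr - 2 - 1) / (a powr - p - 1)\<close>, which is monotone in \<open>a\<close>.\<close>
lemma descent_condition_iff:
  fixes p q a :: real
  assumes "0 < a"
  shows "q * a\<^sup>2 * (1 - a powr p) \<le> p * a powr p * (1 - a\<^sup>2)
      \<longleftrightarrow> q * (a powr (- p) - 1) \<le> p * (a powr (- 2) - 1)"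
proof -
  have "q * (a powr (- p) - 1) \<le> p * (a powr (- 2) - 1) \<longleftrightarrow>
      (a powr p * a\<^sup>2) * (q * (a powr (- p) - 1)) \<le> (a powr p * a\<^sup>2) * (p * (a powr (- 2) - 1))"
    using assms by simp
  also have "a powr (- 2) = 1 / a\<^sup>2"
    using assms by (simp add: powr_minus powr_numeral divide_inverse)
  finally show ?thesis
    using assms by (simp add: powr_minus field_simps)
qed

lemma powr_neg_gt_1:
  fixes a p :: real
  assumes "0 < p" "0 < a" "a < 1"
  shows "1 < a powr (- p)"
  using powr_less_mono2_neg[of "- p" a 1] assms by simp

lemma powr_neg_slope_mono:
  fixes a b m n :: real
  assumes "0 < m" "m \<le> n" "0 < a" "a \<le> b" "b < 1"
  shows "(b powr (- n) - 1) * (a powr (- m) - 1) \<le> (a powr (- n) - 1) * (b powr (- m) - 1)"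
proof -
  have "b powr (- m) \<le> a powr (- m)"
    using assms by (intro powr_mono2') auto
  then show ?thesis
    using powr_slope_mono[of "n / m" "b powr (- m)" "a powr (- m)"] powr_neg_gt_1[of m b] assms
    by (simp add: powr_powr)
qed

lemma descent_condition_below:
  fixes p q a b :: real
  assumes "0 < p" "p \<le> 2" "0 < q" "0 < a" "a \<le> b" "b < 1"
    and "q * b\<^sup>2 * (1 - b powr p) \<le> p * b powr p * (1 - b\<^sup>2)"
  shows "q * a\<^sup>2 * (1 - a powr p) \<le> p * a powr p * (1 - a\<^sup>2)"
proof -
  define u v u' v' where "u = a powr (- p) - 1" "v = a powr (- 2) - 1" "u' = b powr (- p) - 1" "v' = b powr (- 2) - 1"
  note defs = this
  have pos: "0 < u" "0 < u'" using assms powr_neg_gt_1[of p a] powr_neg_gt_1[of p b] by (auto simp: defs)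
  have 1: "v' * u \<le> v * u'" unfolding defs using assms by (intro powr_neg_slope_mono) auto
  have 2: "q * u' \<le> p * v'" using assms by (simp add: descent_condition_iff defs)
  have "(q * u) * u' = (q * u') * u" by simp
  also have "\<dots> \<le> (p * v') * u" using 2 pos by (intro mult_right_mono) auto
  also have "\<dots> = p * (v' * u)" by simp
  also have "\<dots> \<le> p * (v * u')" using 1 assms by (intro mult_left_mono) auto
  finally have "(q * u) * u' \<le> (p * v) * u'" by (simp add: mult.assoc)
  then have "q * u \<le> p * v" using pos by simp
  then show ?thesis using assms by (simp add: descent_condition_iff defs)
qed

lemma descent_condition_above:
  fixes p q a b :: real
  assumes "2 \<le> p" "0 < q" "0 < a" "a \<le> b" "b < 1"
    and "q * a\<^sup>2 * (1 - a powr p) \<le> p * a powr p * (1 - a\<^sup>2)"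
  shows "q * b\<^sup>2 * (1 - b powr p) \<le> p * b powr p * (1 - b\<^sup>2)"
proof -
  define u v u' v' where "u = a powr (- p) - 1" "v = a powr (- 2) - 1" "u' = b powr (- p) - 1" "v' = b powr (- 2) - 1"
  note defs = this
  have pos: "0 < v" "0 < v'" using assms powr_neg_gt_1[of 2 a] powr_neg_gt_1[of 2 b] by (auto simp: defs)
  have 1: "u' * v \<le> u * v'" unfolding defs using assms by (intro powr_neg_slope_mono) auto
  have 2: "q * u \<le> p * v" using assms by (simp add: descent_condition_iff defs)
  have "(q * u') * v = q * (u' * v)" by simp
  also have "\<dots> \<le> q * (u * v')" using 1 assms by (intro mult_left_mono) auto
  also have "\<dots> = (q * u) * v'" by simp
  also have "\<dots> \<le> (p * v) * v'" using 2 pos by (intro mult_right_mono) auto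
  finally have "(q * u') * v \<le> (p * v') * v" by (simp add: mult_ac)
  then have "q * u' \<le> p * v'" using pos by simp
  then show ?thesis using assms by (simp add: descent_condition_iff defs)
qed

lemma descent_condition_of_le_2:
  fixes p q a :: real
  assumes "0 < p" "p \<le> 2" "0 < q" "q \<le> 2" "0 < a" "a < 1"
  shows "q * a\<^sup>2 * (1 - a powr p) \<le> p * a powr p * (1 - a\<^sup>2)"
proof -
  have gt: "1 < a powr (- p)" using assms powr_neg_gt_1 by auto
  have "2 / p * (a powr (- p) - 1) \<le> (a powr (- p)) powr (2 / p) - 1"
    using gt assms by (intro bernoulli_powr) auto
  then have "2 * (a powr (- p) - 1) \<le> p * (a powr (- 2) - 1)"
    using assms by (simp add: powr_powr field_simps)
  moreover have "q * (a powr (- p) - 1) \<le> 2 * (a powr (- p) - 1)"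
    using gt assms by (intro mult_right_mono) auto
  ultimately show ?thesis using assms by (simp add: descent_condition_iff)
qed

subsection \<open>The Bohr radius\<close>

lemma a_hat:
  assumes "0 < p" "0 < q"
  shows "0 < a_hat p q" "a_hat p q < 1" "a_hat p q powr p + a_hat p q powr q = 1"
proof -
  have "\<exists>!x. 0 < x \<and> x < 1 \<and> x powr p + x powr q = 1"
  proof (rule ex_ex1I)
    have "\<exists>x\<ge>0. x \<le> 1 \<and> x powr p + x powr q = 1"
      using assms by (intro IVT') (auto intro!: continuous_on_add continuous_on_powr' continuous_on_id continuous_on_const)
    then obtain x where x: "0 \<le> x" "x \<le> 1" "x powr p + x powr q = 1" by blast
    moreover have "x \<noteq> 0" "x \<noteq> 1" using x(3) by auto
    ultimately show "\<exists>x. 0 < x \<and> x < 1 \<and> x powr p + x powr q = 1"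
      by (intro exI[of _ x]) linarith
  next
    have less: "x powr p + x powr q < y powr p + y powr q" if "0 < x" "x < y" for x y :: real
      using that assms by (intro add_strict_mono powr_less_mono2) auto
    fix x y :: real
    assume "0 < x \<and> x < 1 \<and> x powr p + x powr q = 1" "0 < y \<and> y < 1 \<and> y powr p + y powr q = 1"
    then show "x = y"
      using less[of x y] less[of y x] by (cases x y rule: linorder_cases) auto
  qed
  from theI'[OF this] show "0 < a_hat p q" "a_hat p q < 1" "a_hat p q powr p + a_hat p q powr q = 1"
    by (auto simp: a_hat_def)
qed

lemma slack_a_hat:
  assumes "0 < p" "0 < q"
  shows "slack p q (a_hat p q) = a_hat p q"
proof -
  have "1 - a_hat p q powr p = a_hat p q powr q"
    using a_hat(3)[OF assms] by simp
  then show ?thesis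
    using a_hat(1)[OF assms] assms by (simp add: slack_def powr_powr)
qed

lemma slack_le_self_of_a_hat_le:
  assumes "0 < p" "0 < q" "a_hat p q \<le> a" "a < 1"
  shows "slack p q a \<le> a"
proof -
  have "slack p q a \<le> slack p q (a_hat p q)"
    unfolding slack_def using assms a_hat(1)[of p q] powr_less_one_of_less_one[of p a]
    by (intro powr_mono2) (auto intro!: powr_mono2)
  then show ?thesis using assms by (simp add: slack_a_hat)
qed

lemma A_pq_a_hat:
  assumes "0 < p" "0 < q"
  shows "A_pq p q (a_hat p q) = a_hat p q"
  by (simp add: A_pq_slack slack_a_hat[OF assms] power2_eq_square)

lemma bdd_below_A_pq: "0 < p \<Longrightarrow> 0 < q \<Longrightarrow> bdd_below (A_pq p q ` {a_hat p q..<1})"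
  using A_pq_pos[of p _ q] a_hat(1)[of p q] by (intro bdd_belowI2[where m = 0]) (auto intro!: less_imp_le)

lemma bohr_radius_C_le_INF_A_pq:
  assumes "0 < p" "0 < q"
  shows "bohr_radius_C p q \<le> ereal (INF a\<in>{a_hat p q..<1}. A_pq p q a)"
proof (rule ereal_le_epsilon2)
  fix e :: real assume "0 < e"
  then obtain a where a: "a \<in> {a_hat p q..<1}" "A_pq p q a < (INF a\<in>{a_hat p q..<1}. A_pq p q a) + e"
    using cINF_less_iff[of "{a_hat p q..<1}" "A_pq p q" "(INF a\<in>{a_hat p q..<1}. A_pq p q a) + e"]
      bdd_below_A_pq[OF assms] a_hat(2)[OF assms] by auto
  have "bohr_radius_C p q \<le> ereal (A_pq p q a)"
    using a a_hat(1)[OF assms] assms by (intro bohr_radius_C_le_A_pq) auto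
  also have "\<dots> \<le> ereal (INF a\<in>{a_hat p q..<1}. A_pq p q a) + ereal e"
    using a by simp
  finally show "bohr_radius_C p q \<le> ereal (INF a\<in>{a_hat p q..<1}. A_pq p q a) + ereal e" .
qed

lemma bohr_radius_C_ge_of_le_INF_A_pq:
  assumes pq: "0 < p" "0 < q" and c: "0 \<le> c" "c \<le> (INF a\<in>{a_hat p q..<1}. A_pq p q a)"
    and S: "\<And>a. 0 \<le> a \<Longrightarrow> a < a_hat p q \<Longrightarrow> c \<le> S_pq p q a"
  shows "ereal c \<le> bohr_radius_C p q"
proof (rule bohr_radius_C_ge[OF pq c(1)])
  have c_le: "c \<le> A_pq p q a" if "a_hat p q \<le> a" "a < 1" for a
    using that c(2) cINF_lower[OF bdd_below_A_pq[OF pq], of a] by auto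
  show "c \<le> 1"
    using c_le[of "a_hat p q"] a_hat(2)[OF pq] by (simp add: A_pq_a_hat[OF pq])
  fix a :: real assume a: "0 \<le> a" "a < 1"
  show "c \<le> S_pq p q a \<or> c \<le> A_pq p q a \<and> c \<le> a"
  proof (cases "a < a_hat p q")
    case False
    then show ?thesis
      using c_le[of a] a A_pq_le_self[OF a slack_le_self_of_a_hat_le[OF pq]] by force
  qed (use S a in auto)
qed

lemma INF_A_pq_bounds:
  assumes "0 < p" "0 < q"
  shows "0 \<le> (INF a\<in>{a_hat p q..<1}. A_pq p q a)" "(INF a\<in>{a_hat p q..<1}. A_pq p q a) \<le> a_hat p q"
proof -
  show "0 \<le> (INF a\<in>{a_hat p q..<1}. A_pq p q a)"
    using a_hat(1,2)[OF assms] A_pq_pos[of p _ q] assms by (intro cINF_greatest) (auto intro!: less_imp_le)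
  show "(INF a\<in>{a_hat p q..<1}. A_pq p q a) \<le> a_hat p q"
    using cINF_lower[OF bdd_below_A_pq[OF assms], of "a_hat p q"] a_hat(2)[OF assms]
    by (simp add: A_pq_a_hat[OF assms])
qed

lemma a_hat_le_S_pq:
  assumes pq: "0 < p" "0 < q" and a: "0 \<le> a" "a \<le> a_hat p q"
    and "\<And>b. a < b \<Longrightarrow> b < a_hat p q \<Longrightarrow> q * b\<^sup>2 * (1 - b powr p) \<le> p * b powr p * (1 - b\<^sup>2)"
  shows "a_hat p q \<le> S_pq p q a"
  using slack_ratio_antimono_on[OF pq a _ assms(5)] a a_hat(1,2)[OF pq]
  by (simp add: le_S_pq_iff slack_a_hat[OF pq])

lemma bohr_radius_C_eq_INF_A_pq:
  assumes pq: "0 < p" "0 < q"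
    and "\<And>b. 0 < b \<Longrightarrow> b < a_hat p q \<Longrightarrow> q * b\<^sup>2 * (1 - b powr p) \<le> p * b powr p * (1 - b\<^sup>2)"
  shows "bohr_radius_C p q = ereal (INF a\<in>{a_hat p q..<1}. A_pq p q a)"
proof (rule antisym[OF bohr_radius_C_le_INF_A_pq[OF pq]])
  show "ereal (INF a\<in>{a_hat p q..<1}. A_pq p q a) \<le> bohr_radius_C p q"
    using INF_A_pq_bounds[OF pq] a_hat_le_S_pq[OF pq] assms(3)
    by (intro bohr_radius_C_ge_of_le_INF_A_pq[OF pq]) (auto intro: order.trans)
qed

lemma inverse_sqrt_2_le_S_pq_iff:
  assumes "0 \<le> a" "a < 1"
  shows "1 / sqrt 2 \<le> S_pq p q a \<longleftrightarrow> 1 - a\<^sup>2 \<le> (slack p q a)\<^sup>2"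
  using assms by (subst le_S_pq_iff) (auto simp: power_divide)

lemma min_le_S_pq:
  assumes p: "2 \<le> p" and q: "0 < q" and a: "0 \<le> a" "a < a_hat p q"
  shows "min (1 / sqrt 2) (a_hat p q) \<le> S_pq p q a"
proof -
  have pq: "0 < p" "0 < q" using p q by auto
  note h = a_hat(1,2)[OF pq]
  consider "a = 0" | "0 < a" "q * a\<^sup>2 * (1 - a powr p) \<le> p * a powr p * (1 - a\<^sup>2)"
    | "0 < a" "\<not> q * a\<^sup>2 * (1 - a powr p) \<le> p * a powr p * (1 - a\<^sup>2)"
    using a by force
  then show ?thesis
  proof cases
    case 1
    then have "1 / sqrt 2 \<le> S_pq p q a" by (subst inverse_sqrt_2_le_S_pq_iff) (auto simp: slack_def)
    then show ?thesis by auto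
  next
    case 2
    then have "a_hat p q \<le> S_pq p q a"
      using a h by (intro a_hat_le_S_pq[OF pq]) (auto intro: descent_condition_above[OF p q 2(1)])
    then show ?thesis by auto
  next
    case 3
    have "(slack p q 0)\<^sup>2 * (1 - a\<^sup>2) \<le> (slack p q a)\<^sup>2 * (1 - 0\<^sup>2)"
    proof (rule slack_ratio_mono_on[OF pq])
      fix b assume b: "0 < b" "b < a"
      show "p * b powr p * (1 - b\<^sup>2) \<le> q * b\<^sup>2 * (1 - b powr p)"
        using descent_condition_above[OF p q b(1), of a] b 3 a h by force
    qed (use a h in auto)
    then have "1 / sqrt 2 \<le> S_pq p q a"
      using a h by (subst inverse_sqrt_2_le_S_pq_iff) (auto simp: slack_def)
    then show ?thesis by auto
  qed
qed

lemma bohr_radius_C_eq_min: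
  assumes "2 \<le> p" "0 < q"
  shows "bohr_radius_C p q = ereal (min (1 / sqrt 2) (INF a\<in>{a_hat p q..<1}. A_pq p q a))"
proof (rule antisym)
  have pq: "0 < p" "0 < q" using assms by auto
  show "bohr_radius_C p q \<le> ereal (min (1 / sqrt 2) (INF a\<in>{a_hat p q..<1}. A_pq p q a))"
    using bohr_radius_C_le_INF_A_pq[OF pq] bohr_radius_C_le_inverse_sqrt_2[OF pq] by (simp add: min_def)
  show "ereal (min (1 / sqrt 2) (INF a\<in>{a_hat p q..<1}. A_pq p q a)) \<le> bohr_radius_C p q"
    using INF_A_pq_bounds[OF pq] min_le_S_pq[OF assms]
    by (intro bohr_radius_C_ge_of_le_INF_A_pq[OF pq]) (fastforce simp: min_le_iff_disj)+
qed

lemma one_minus_powr_le_slack_square: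
  assumes "0 < p" "2 \<le> q" "0 \<le> a" "a < 1"
  shows "1 - a powr p \<le> (slack p q a)\<^sup>2"
proof -
  define x where "x = 1 - a powr p"
  have x: "0 < x" "x \<le> 1"
    using powr_less_one_of_less_one[of p a] assms by (auto simp: x_def)
  then have "x \<le> x powr (2 / q)"
    using powr_mono'[of "2 / q" 1 x] assms by simp
  also have "x powr (2 / q) = (slack p q a)\<^sup>2"
    using x by (simp add: slack_def powr_power x_def)
  finally show ?thesis by (simp add: x_def)
qed

lemma one_minus_square_le_slack_square:
  assumes "2 \<le> p" "2 \<le> q" "0 \<le> a" "a < 1"
  shows "1 - a\<^sup>2 \<le> (slack p q a)\<^sup>2"
proof -
  have "a powr p \<le> a\<^sup>2"
    using assms powr_mono'[of 2 p a] by (cases "a = 0") (auto simp: powr_numeral)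
  then show ?thesis
    using one_minus_powr_le_slack_square[of p q a] assms by simp
qed

lemma bohr_radius_C_ge_INF_S_pq:
  assumes pq: "0 < p" "0 < q"
  shows "ereal (INF a\<in>{0..<1}. S_pq p q a) \<le> bohr_radius_C p q"
proof -
  have S_nonneg: "0 \<le> S_pq p q a" if "0 \<le> a" "a < 1" for a
    using that by (subst le_S_pq_iff) auto
  have bdd: "bdd_below (S_pq p q ` {0..<1})"
    using S_nonneg by (intro bdd_belowI2[where m = 0]) auto
  have le: "(INF a\<in>{0..<1}. S_pq p q a) \<le> S_pq p q a" if "0 \<le> a" "a < 1" for a
    using that by (intro cINF_lower bdd) auto
  have "S_pq p q 0 \<le> 1"
    by (simp add: S_pq_def)
  then have "(INF a\<in>{0..<1}. S_pq p q a) \<le> 1"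
    using le[of 0] by linarith
  then show ?thesis
    using le S_nonneg by (intro bohr_radius_C_ge[OF pq]) (auto intro!: cINF_greatest)
qed

lemma bohr_radius_C_eq_inverse_sqrt_2:
  assumes "2 \<le> p" "2 \<le> q"
  shows "bohr_radius_C p q = ereal (1 / sqrt 2)"
proof (rule antisym)
  show "bohr_radius_C p q \<le> ereal (1 / sqrt 2)"
    using assms by (intro bohr_radius_C_le_inverse_sqrt_2) auto
  show "ereal (1 / sqrt 2) \<le> bohr_radius_C p q"
    using assms by (intro bohr_radius_C_ge)
      (auto simp: inverse_sqrt_2_le_S_pq_iff one_minus_square_le_slack_square)
qed

lemma INF_S_pq_pos:
  assumes "1 \<le> p" "2 \<le> q"
  shows "0 < (INF a\<in>{0..<1}. S_pq p q a)"
proof -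
  have "1 / 2 \<le> S_pq p q a" if a: "0 \<le> a" "a < 1" for a
  proof -
    have "a powr p \<le> a"
      using assms powr_mono'[of 1 p a] a by (cases "a = 0") auto
    moreover have "1 - a powr p \<le> (slack p q a)\<^sup>2"
      using assms a by (intro one_minus_powr_le_slack_square) auto
    ultimately have *: "2 * (1 - a) \<le> 2 * (slack p q a)\<^sup>2"
      by simp
    have "1 - a\<^sup>2 \<le> 2 * (1 - a)"
      using sum_squares_ge_zero[of "1 - a" 0] by (simp add: power2_eq_square algebra_simps)
    also note *
    also have "2 * (slack p q a)\<^sup>2 \<le> 3 * (slack p q a)\<^sup>2"
      by simp
    finally have "1 - a\<^sup>2 \<le> 3 * (slack p q a)\<^sup>2" .
    then show ?thesis using a by (subst le_S_pq_iff) (auto simp: power2_eq_square)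
  qed
  then have "1 / 2 \<le> (INF a\<in>{0..<1}. S_pq p q a)"
    by (intro cINF_greatest) auto
  then show ?thesis by linarith
qed

theorem theorem1p1:
  fixes p q :: real
  assumes "1 \<le> p" and "1 \<le> q"
  shows
   "(p \<le> 2 \<and> q \<le> 2 \<longrightarrow>
       bohr_radius_C p q = ereal (INF a\<in>{a_hat p q..<1}. A_pq p q a))
  \<and> (2 < p \<and> q \<le> 2 \<longrightarrow>
       bohr_radius_C p q = ereal (min (1 / sqrt 2) (INF a\<in>{a_hat p q..<1}. A_pq p q a)))
  \<and> (2 \<le> p \<and> 2 \<le> q \<longrightarrow> bohr_radius_C p q = ereal (1 / sqrt 2))
  \<and> (2 < q \<longrightarrow> bohr_radius_C 2 q = ereal (1 / sqrt 2))
  \<and> (p < 2 \<and> 2 < q \<and>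
       q * (a_hat p q)^2 + p * (a_hat p q) powr (p + 2)
         \<le> p * (a_hat p q) powr p + q * (a_hat p q) powr (p + 2) \<longrightarrow>
       bohr_radius_C p q = ereal (INF a\<in>{a_hat p q..<1}. A_pq p q a))
  \<and> (p < 2 \<and> 2 < q \<longrightarrow>
       0 < (INF a\<in>{0..<1}. S_pq p q a)
       \<and> ereal (INF a\<in>{0..<1}. S_pq p q a) \<le> bohr_radius_C p q
       \<and> bohr_radius_C p q \<le> ereal (1 / sqrt 2))"
proof (intro conjI impI; (elim conjE)?)
  have pq: "0 < p" "0 < q" using assms by auto
  note h = a_hat(1,2)[OF pq]
  show "bohr_radius_C p q = ereal (INF a\<in>{a_hat p q..<1}. A_pq p q a)" if "p \<le> 2" "q \<le> 2"
    using that h pq by (intro bohr_radius_C_eq_INF_A_pq descent_condition_of_le_2) auto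
  show "bohr_radius_C p q = ereal (INF a\<in>{a_hat p q..<1}. A_pq p q a)"
    if "p < 2" and cond: "q * (a_hat p q)^2 + p * (a_hat p q) powr (p + 2)
         \<le> p * (a_hat p q) powr p + q * (a_hat p q) powr (p + 2)"
  proof (rule bohr_radius_C_eq_INF_A_pq[OF pq])
    have "q * (a_hat p q)\<^sup>2 * (1 - a_hat p q powr p) \<le> p * a_hat p q powr p * (1 - (a_hat p q)\<^sup>2)"
      using cond h by (simp add: powr_add powr_numeral algebra_simps)
    then show "q * b\<^sup>2 * (1 - b powr p) \<le> p * b powr p * (1 - b\<^sup>2)" if "0 < b" "b < a_hat p q" for b
      using that \<open>p < 2\<close> pq h by (intro descent_condition_below[of p q b "a_hat p q"]) auto
  qed
qed (use assms bohr_radius_C_eq_min bohr_radius_C_eq_inverse_sqrt_2 INF_S_pq_pos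
      bohr_radius_C_ge_INF_S_pq bohr_radius_C_le_inverse_sqrt_2 in auto)

end
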